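(* Let $\mu$ be a non-trivial probability measure supported on $[-1,1]$ with $\mathcal S$-function $S$, and let $\sigma=\mathrm{Sz}(\mu)$ with monic orthogonal polynomials $\{\Phi_n\}_{n\ge0}$ and second kind polynomials $\{\Omega_n\}_{n\ge0}$. Let $k\ge1$ and let $\hat S^{(k)}$ be the $\mathcal S$-function corresponding, through the Szegő transformation, to the associated polynomials of order $k$ on the unit circle, $\{\Phi_n^{(k)}\}_{n\ge0}$. Then $$\sqrt{x^2-1}\,\hat S^{(k)}(x)\ \dot=\ \boldsymbol\Upsilon^{(k)}\!\left(x-\sqrt{x^2-1}\right)\left(\sqrt{x^2-1}\,S(x)\right),$$ where $$\boldsymbol\Upsilon^{(k)}(z)=\begin{bmatrix}\Phi_k(z)+\Phi_k^*(z)&\Omega_k(z)-\Omega_k^*(z)\\ \Phi_k(z)-\Phi_k^*(z)&\Omega_k(z)+\Omega_k^*(z)\end{bmatrix},\qquad z=x-\sqrt{x^2-1}.$$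
   Context: Notation $\dot=$: for a $2\times2$ matrix of functions, $f\ \dot=\ \begin{bmatrix}a&b\\c&d\end{bmatrix}g$ means $f=\dfrac{a g+b}{c g+d}$. The $\mathcal S$-function of a probability measure $\nu$ on $[-1,1]$ is $S_\nu(x)=\int\frac{d\nu(y)}{x-y}$, $x\in\mathbb C\setminus[-1,1]$. The branch of $\sqrt{x^2-1}$ on $\mathbb C\setminus[-1,1]$ is the one for which $|x-\sqrt{x^2-1}|<1$, so $2x=z+z^{-1}$ with $0<|z|<1$. For a non-trivial probability measure on the unit circle with monic orthogonal polynomials $\Phi_n$, the Verblunsky coefficients are $\alpha_n=-\overline{\Phi_{n+1}(0)}$, $n\ge0$, and $\Phi_{n+1}(z)=z\Phi_n(z)-\overline{\alpha_n}\Phi_n^*(z)$, $\Phi_0=1$. For a polynomial $Q_n$ of degree $n$ in such a sequence, $Q_n^*(z)=z^n\overline{Q_n(1/\bar z)}$. The second kind polynomials $\Omega_n$ are obtained from the same recurrence with $\{\alpha_n\}$ replaced by $\{-\alpha_n\}$. The associated polynomials of order $k$, $\{\Phi_n^{(k)}\}$, are those with Verblunsky coefficients $\{\alpha_{n+k}\}_{n\ge0}$, orthogonal with respect to a probability measure $\sigma^{(k)}$ on the circle. Szegő transformation: a probability measure $\nu$ on $[-1,1]$ is sent to the probability measure $\mathrm{Sz}(\nu)$ on the unit circle given by $d\,\mathrm{Sz}(\nu)(\theta)=\frac12|d\nu(\cos\theta)|$, i.e. the measure invariant under $\theta\mapsto-\theta$ whose push-forward under $e^{i\theta}\mapsto\cos\theta$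 is $\nu$. Its Verblunsky coefficients are in $(-1,1)$, and each probability measure on the circle with all Verblunsky coefficients in $(-1,1)$ is $\mathrm{Sz}(\nu)$ for a unique $\nu$. $\hat S^{(k)}$ is the $\mathcal S$-function of the measure $\hat\mu$ on $[-1,1]$ with $\mathrm{Sz}(\hat\mu)=\sigma^{(k)}$. *)

theory Defs
  imports "HOL-Probability.Probability" "HOL-Computational_Algebra.Polynomial"
begin

definition prob_on :: "'a::topological_space set \<Rightarrow> 'a measure \<Rightarrow> bool" where
  "prob_on A M \<longleftrightarrow> prob_space M \<and> sets M = sets borel \<and> (AE x in M. x \<in> A)"

text \<open>A measure is non-trivial if its support is infinite, i.e. no finite set carries it.\<close>

definition nontrivial :: "'a measure \<Rightarrow> bool" where
  "nontrivial M \<longleftrightarrow> \<not> (\<exists>A. finite A \<and> (AE x in M. x \<in> A))"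

definition S_function :: "real measure \<Rightarrow> complex \<Rightarrow> complex" where
  "S_function \<nu> x = (\<integral>y. 1 / (x - complex_of_real y) \<partial>\<nu>)"

text \<open>The branch of \<open>sqrt (x\<^sup>2 - 1)\<close> off the interval \<open>[-1,1]\<close>; there, exactly one of the two
  square roots satisfies the inequality.\<close>

definition sqrt_branch :: "complex \<Rightarrow> complex" where
  "sqrt_branch x = (THE w. w\<^sup>2 = x\<^sup>2 - 1 \<and> cmod (x - w) < 1)"

definition monic_orthogonal :: "complex measure \<Rightarrow> nat \<Rightarrow> complex poly \<Rightarrow> bool" where
  "monic_orthogonal \<sigma> n p \<longleftrightarrow> degree p = n \<and> lead_coeff p = 1 \<and>
     (\<forall>q. degree q < n \<longrightarrow> (\<integral>w. poly p w * cnj (poly q w) \<partial>\<sigma>) = 0)"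

definition opuc :: "complex measure \<Rightarrow> nat \<Rightarrow> complex poly" where
  "opuc \<sigma> n = (THE p. monic_orthogonal \<sigma> n p)"

definition verblunsky :: "complex measure \<Rightarrow> nat \<Rightarrow> complex" where
  "verblunsky \<sigma> n = - cnj (poly (opuc \<sigma> (Suc n)) 0)"

text \<open>The reversed polynomial \<open>z^n * cnj (Q (1 / cnj z))\<close> with \<open>n = degree Q\<close>.\<close>

definition rev_poly :: "complex poly \<Rightarrow> complex poly" where
  "rev_poly Q = reflect_poly (map_poly cnj Q)"

lemma poly_rev_poly:
  assumes "z \<noteq> 0"
  shows "poly (rev_poly Q) z = z ^ degree Q * cnj (poly Q (1 / cnj z))"
proof -
  have "poly (map_poly cnj Q) (inverse z) = cnj (poly Q (1 / cnj z))"
    by (simp add: poly_altdef degree_map_poly coeff_map_poly divide_inverse)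
  with assms show ?thesis
    by (simp add: rev_poly_def poly_reflect_poly_nz degree_map_poly)
qed

primrec szego_rec :: "(nat \<Rightarrow> complex) \<Rightarrow> nat \<Rightarrow> complex poly" where
  "szego_rec \<alpha> 0 = 1"
| "szego_rec \<alpha> (Suc n) =
     pCons 0 (szego_rec \<alpha> n) - smult (cnj (\<alpha> n)) (rev_poly (szego_rec \<alpha> n))"

definition second_kind :: "complex measure \<Rightarrow> nat \<Rightarrow> complex poly" where
  "second_kind \<sigma> = szego_rec (\<lambda>n. - verblunsky \<sigma> n)"

definition associated_opuc :: "complex measure \<Rightarrow> nat \<Rightarrow> nat \<Rightarrow> complex poly" where
  "associated_opuc \<sigma> k = szego_rec (\<lambda>n. verblunsky \<sigma> (n + k))"

text \<open>The point \<open>y\<close> is lifted to \<open>y + i s sqrt (1 - y\<^sup>2)\<close>, where the sign \<open>s\<close> is uniformly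
  distributed and independent of \<open>y\<close>. The result is invariant under
  complex conjugation (\<open>distr_cnj_szego_transform\<close>) and its push-forward under the real part
  is \<open>\<nu>\<close> (\<open>distr_Re_szego_transform\<close>).\<close>

definition szego_transform :: "real measure \<Rightarrow> complex measure" where
  "szego_transform \<nu> = distr (\<nu> \<Otimes>\<^sub>M measure_pmf (pmf_of_set {1, -1 :: real})) borel
     (\<lambda>(y, s). Complex y (s * sqrt (1 - y\<^sup>2)))"

lemma measurable_szego_lift:
  assumes "sets \<nu> = sets borel"
  shows "(\<lambda>(y, s). Complex y (s * sqrt (1 - y\<^sup>2)))
           \<in> borel_measurable (\<nu> \<Otimes>\<^sub>M measure_pmf (p :: real pmf))"
proof -
  have [measurable_cong]: "sets \<nu> = sets borel" by fact
  have [measurable]: "(\<lambda>s. s) \<in> borel_measurable (measure_pmf p)" by simp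
  have "(\<lambda>w. complex_of_real (fst w) + \<i> * complex_of_real (snd w * sqrt (1 - (fst w)\<^sup>2)))
      \<in> borel_measurable (\<nu> \<Otimes>\<^sub>M measure_pmf p)"
    by measurable
  then show ?thesis by (simp add: case_prod_unfold Complex_eq)
qed

lemma distr_Re_szego_transform:
  assumes "sets \<nu> = sets borel"
  shows "distr (szego_transform \<nu>) borel Re = \<nu>"
proof -
  let ?P = "measure_pmf (pmf_of_set {1, -1 :: real})"
  have "distr (szego_transform \<nu>) borel Re = distr (\<nu> \<Otimes>\<^sub>M ?P) borel fst"
    unfolding szego_transform_def using measurable_szego_lift[OF assms]
    by (subst distr_distr) (auto simp: comp_def case_prod_unfold)
  also have "\<dots> = distr (\<nu> \<Otimes>\<^sub>M ?P) \<nu> fst"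
    using assms by (intro distr_cong) auto
  also have "\<dots> = \<nu>"
    by (simp add: prob_space.distr_pair_fst measure_pmf.prob_space_axioms)
  finally show ?thesis .
qed

lemma distr_cnj_szego_transform:
  assumes "sigma_finite_measure \<nu>" "sets \<nu> = sets borel"
  shows "distr (szego_transform \<nu>) borel cnj = szego_transform \<nu>"
proof -
  let ?p = "pmf_of_set {1, -1 :: real}"
  let ?f = "\<lambda>(y, s). Complex y (s * sqrt (1 - y\<^sup>2))"
  have "map_pmf uminus ?p = ?p"
    by (subst map_pmf_of_set_inj) (auto simp: insert_commute)
  then have "distr (measure_pmf ?p) (count_space UNIV) uminus = measure_pmf ?p"
    by (simp flip: map_pmf_rep_eq)
  moreover have "distr (measure_pmf ?p) (measure_pmf ?p) uminus
      = distr (measure_pmf ?p) (count_space UNIV) uminus"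
    by (rule distr_cong) simp_all
  ultimately have p: "distr (measure_pmf ?p) (measure_pmf ?p) uminus = measure_pmf ?p"
    by simp
  have "\<nu> \<Otimes>\<^sub>M measure_pmf ?p
      = distr \<nu> \<nu> id \<Otimes>\<^sub>M distr (measure_pmf ?p) (measure_pmf ?p) uminus"
    by (simp add: p id_def distr_id)
  also have "\<dots> = distr (\<nu> \<Otimes>\<^sub>M measure_pmf ?p) (\<nu> \<Otimes>\<^sub>M measure_pmf ?p) (\<lambda>(y, s). (id y, - s))"
    by (rule pair_measure_distr) (auto simp: p measure_pmf.sigma_finite_measure_axioms)
  finally have q: "\<nu> \<Otimes>\<^sub>M measure_pmf ?p
      = distr (\<nu> \<Otimes>\<^sub>M measure_pmf ?p) (\<nu> \<Otimes>\<^sub>M measure_pmf ?p) (\<lambda>(y, s). (id y, - s))" .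
  have m: "(\<lambda>(y, s). (id y, - s)) \<in> \<nu> \<Otimes>\<^sub>M measure_pmf ?p \<rightarrow>\<^sub>M \<nu> \<Otimes>\<^sub>M measure_pmf ?p"
    by (auto simp: case_prod_unfold intro!: measurable_Pair measurable_compose[OF measurable_snd])
  have "szego_transform \<nu> = distr (\<nu> \<Otimes>\<^sub>M measure_pmf ?p) borel (?f \<circ> (\<lambda>(y, s). (id y, - s)))"
    unfolding szego_transform_def
    by (subst q, subst distr_distr) (use m measurable_szego_lift[OF assms(2)] in auto)
  also have "\<dots> = distr (szego_transform \<nu>) borel cnj"
    unfolding szego_transform_def using measurable_szego_lift[OF assms(2), of ?p]
    by (subst distr_distr)
      (auto simp: comp_def case_prod_unfold complex_cnj
         intro!: borel_measurable_continuous_onI continuous_intros)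
  finally show ?thesis by simp
qed

text \<open>The relation includes that the denominator does not vanish, so that the value of a division
  by zero plays no role.\<close>

definition lft_eq :: "complex \<Rightarrow> complex^2^2 \<Rightarrow> complex \<Rightarrow> bool" where
  "lft_eq f M g \<longleftrightarrow> M$2$1 * g + M$2$2 \<noteq> 0 \<and>
     f = (M$1$1 * g + M$1$2) / (M$2$1 * g + M$2$2)"

definition Upsilon :: "(nat \<Rightarrow> complex poly) \<Rightarrow> (nat \<Rightarrow> complex poly) \<Rightarrow> nat \<Rightarrow> complex
    \<Rightarrow> complex^2^2" where
  "Upsilon \<Phi> \<Omega> k z = vector
     [vector [poly (\<Phi> k) z + poly (rev_poly (\<Phi> k)) z, poly (\<Omega> k) z - poly (rev_poly (\<Omega> k)) z],
      vector [poly (\<Phi> k) z - poly (rev_poly (\<Phi> k)) z, poly (\<Omega> k) z + poly (rev_poly (\<Omega> k)) z]]"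

end

theory Submission
  imports Defs
begin

text \<open>
  The branch of the square root makes \<open>sqrt (x\<^sup>2 - 1) * S x\<close> the Caratheodory function
  \<open>F z = \<integral> (w + z) / (w - z) \<partial>\<sigma>\<close> of the Szego transform, where \<open>2 x = z + 1 / z\<close>. The functions
  \<open>u\<^sub>n = \<Phi>\<^sub>n F + \<Omega>\<^sub>n\<close> and \<open>v\<^sub>n = \<Phi>\<^sub>n\<^sup>* F - \<Omega>\<^sub>n\<^sup>*\<close> satisfy a linear recurrence whose step has
  determinant \<open>z (1 - |\<alpha>\<^sub>n|\<^sup>2)\<close>, and orthogonality gives \<open>u\<^sub>n, v\<^sub>n = O(|z|^n \<parallel>\<Phi>\<^sub>n\<parallel>)\<close>. If \<open>u', v'\<close> belong to
  the associated polynomials of order \<open>k\<close>, then \<open>W\<^sub>n = u\<^bsub>n+k\<^esub> v'\<^sub>n - v\<^bsub>n+k\<^esub> u'\<^sub>n\<close> equals \<open>W\<^sub>0\<close> times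
  \<open>z^n \<parallel>\<Phi>'\<^sub>n\<parallel>\<^sup>2\<close> and is \<open>O(|z|^(2 n) \<parallel>\<Phi>'\<^sub>n\<parallel>\<^sup>2)\<close>. Hence \<open>W\<^sub>0 = 0\<close>, which is the asserted relation between
  \<open>F\<close> and \<open>F'\<close>.
\<close>

section \<open>The Szego recurrence\<close>

lemma degree_rev_poly_le: "degree (rev_poly P) \<le> degree P"
  unfolding rev_poly_def by (metis degree_reflect_poly_le degree_map_poly complex_cnj_zero_iff)

lemma coeff_0_rev_poly: "coeff (rev_poly P) 0 = cnj (lead_coeff P)"
  by (simp add: rev_poly_def degree_map_poly coeff_map_poly)

lemma circle_mult_cnj: "cmod w = 1 \<Longrightarrow> w * cnj w = 1"
  by (metis complex_norm_square of_real_1 one_power2)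

lemma poly_rev_poly_circle:
  assumes "cmod w = 1"
  shows "poly (rev_poly P) w = w ^ degree P * cnj (poly P w)"
proof -
  have "w * cnj w = 1" using assms by (simp add: circle_mult_cnj)
  then have "w \<noteq> 0" by auto
  then have "1 / cnj w = w" using \<open>w * cnj w = 1\<close> by (simp add: divide_eq_eq)
  note this \<open>w \<noteq> 0\<close>
  then show ?thesis by (simp add: poly_rev_poly)
qed

text \<open>Reversal does not raise the degree, so the subtracted term cannot reach the top
  coefficient of \<open>pCons 0 P\<close>.\<close>

lemma degree_lead_coeff_szego_step:
  assumes "lead_coeff P = 1"
  shows "degree (pCons 0 P - smult c (rev_poly P)) = Suc (degree P)"
    and "lead_coeff (pCons 0 P - smult c (rev_poly P)) = 1"
proof -
  let ?Q = "pCons 0 P - smult c (rev_poly P)"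
  have d: "degree (smult c (rev_poly P)) < Suc (degree P)"
    using degree_rev_poly_le[of P] degree_smult_le[of c "rev_poly P"] by linarith
  have "P \<noteq> 0" using assms by auto
  then have p: "degree (pCons 0 P) = Suc (degree P)" by simp
  have c: "coeff ?Q (Suc (degree P)) = 1"
    using assms coeff_eq_0[OF d] by simp
  have "degree ?Q \<le> Suc (degree P)"
    using p d by (intro degree_diff_le) auto
  moreover have "Suc (degree P) \<le> degree ?Q" using c by (intro le_degree) auto
  ultimately show "degree ?Q = Suc (degree P)" by simp
  with c show "lead_coeff ?Q = 1" by simp
qed

lemma degree_lead_coeff_szego_rec:
  "degree (szego_rec \<alpha> n) = n \<and> lead_coeff (szego_rec \<alpha> n) = 1"
proof (induction n)
  case (Suc n)
  then show ?case
    using degree_lead_coeff_szego_step[of "szego_rec \<alpha> n" "cnj (\<alpha> n)"] by auto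
qed simp

lemma degree_szego_rec [simp]: "degree (szego_rec \<alpha> n) = n"
  by (simp add: degree_lead_coeff_szego_rec)

lemma poly_rev_szego_rec_0 [simp]: "poly (rev_poly (szego_rec \<alpha> n)) 0 = 1"
  using degree_lead_coeff_szego_rec[of \<alpha> n] by (simp add: poly_0_coeff_0 coeff_0_rev_poly)

text \<open>The reversal of the recurrence itself, obtained by evaluating at
  \<open>1 / cnj z\<close>. The formula \<open>poly_rev_poly\<close> excludes the origin, where both
  sides are 1.\<close>

lemma poly_rev_szego_rec_Suc:
  "poly (rev_poly (szego_rec \<alpha> (Suc n))) z =
     poly (rev_poly (szego_rec \<alpha> n)) z - \<alpha> n * z * poly (szego_rec \<alpha> n) z"
proof (cases "z = 0")
  case True
  then show ?thesis by (simp only: poly_rev_szego_rec_0) simp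
next
  case False
  let ?P = "szego_rec \<alpha> n"
  have nz: "1 / cnj z \<noteq> 0" using False by simp
  have "poly (rev_poly (szego_rec \<alpha> (Suc n))) z =
      z ^ Suc n * cnj (poly (szego_rec \<alpha> (Suc n)) (1 / cnj z))"
    using False poly_rev_poly[of z "szego_rec \<alpha> (Suc n)"] degree_szego_rec[of \<alpha> "Suc n"] by simp
  also have "\<dots> = z ^ Suc n * (cnj (poly ?P (1 / cnj z)) / z - \<alpha> n * ((1 / z) ^ n * poly ?P z))"
    using poly_rev_poly[OF nz, of ?P] by simp
  also have "\<dots> = z ^ n * cnj (poly ?P (1 / cnj z)) - \<alpha> n * z * poly ?P z"
    using False by (simp add: field_simps)
  finally show ?thesis using False by (simp add: poly_rev_poly)
qed

section \<open>Orthogonality on the unit circle\<close>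

locale circle_measure =
  fixes \<sigma> :: "complex measure"
  assumes prob_on_circle: "prob_on (sphere 0 1) \<sigma>"
begin

sublocale prob_space \<sigma>
  using prob_on_circle by (simp add: prob_on_def)

lemma sets_eq [measurable_cong]: "sets \<sigma> = sets borel"
  using prob_on_circle by (simp add: prob_on_def)

lemma AE_circle: "AE w in \<sigma>. cmod w = 1"
  using prob_on_circle by (simp add: prob_on_def)

text \<open>A continuous function is bounded on the compact circle, which carries the finite
  measure. Continuity is asked only there, so kernels with a pole inside the disc are
  covered.\<close>

lemma integrable_circle:
  fixes f :: "complex \<Rightarrow> 'b :: {banach, second_countable_topology}"
  assumes "f \<in> borel_measurable borel" and "continuous_on (sphere 0 1) f"
  shows "integrable \<sigma> f"
proof -
  have "bounded (f ` sphere 0 1)"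
    using assms(2) by (intro compact_imp_bounded compact_continuous_image) auto
  then obtain B where "\<forall>w\<in>sphere 0 1. norm (f w) \<le> B"
    by (auto simp: bounded_iff)
  then have "AE w in \<sigma>. norm (f w) \<le> B" using AE_circle by auto
  moreover have "f \<in> borel_measurable \<sigma>" using assms(1) sets_eq by measurable
  ultimately show ?thesis by (intro integrable_const_bound)
qed

lemma measurable_poly [measurable]: "poly (p :: complex poly) \<in> borel_measurable borel"
  by (intro borel_measurable_continuous_onI continuous_intros)

lemma measurable_cnj [measurable]: "cnj \<in> borel_measurable borel"
  by (intro borel_measurable_continuous_onI continuous_intros)

lemma integral_circle_cong:
  fixes f g :: "complex \<Rightarrow> 'b :: {banach, second_countable_topology}"
  assumes "f \<in> borel_measurable borel" "g \<in> borel_measurable borel"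
    and "\<And>w. cmod w = 1 \<Longrightarrow> f w = g w"
  shows "integral\<^sup>L \<sigma> f = integral\<^sup>L \<sigma> g"
proof (rule integral_cong_AE)
  show "AE w in \<sigma>. f w = g w" using AE_circle assms(3) by auto
qed (use assms sets_eq in measurable)

section \<open>The L2 norm and the orthogonality relations of a polynomial and its reversal\<close>

definition sqnorm :: "complex poly \<Rightarrow> real" where
  "sqnorm p = (\<integral>w. (cmod (poly p w))\<^sup>2 \<partial>\<sigma>)"

lemma sqnorm_nonneg: "0 \<le> sqnorm p"
  unfolding sqnorm_def by (intro integral_nonneg_AE) auto

lemma of_real_sqnorm: "complex_of_real (sqnorm p) = (\<integral>w. poly p w * cnj (poly p w) \<partial>\<sigma>)"
  unfolding sqnorm_def by (simp flip: integral_complex_of_real complex_norm_square of_real_power)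

lemma sqnorm_rev_poly: "sqnorm (rev_poly p) = sqnorm p"
  unfolding sqnorm_def
  by (intro integral_circle_cong) (auto simp: poly_rev_poly_circle norm_mult norm_power)

text \<open>The Cauchy-Schwarz inequality on a probability space, read off from the nonnegativity of
  a variance.\<close>

lemma integral_norm_poly_le: "(\<integral>w. cmod (poly p w) \<partial>\<sigma>) \<le> sqrt (sqnorm p)"
proof -
  have "integrable \<sigma> (\<lambda>w. cmod (poly p w))" "integrable \<sigma> (\<lambda>w. (cmod (poly p w))\<^sup>2)"
    by (intro integrable_circle continuous_intros; measurable)+
  then have "sqnorm p - (\<integral>w. cmod (poly p w) \<partial>\<sigma>)\<^sup>2 = variance (\<lambda>w. cmod (poly p w))"
    unfolding sqnorm_def by (intro variance_eq[symmetric])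
  also have "\<dots> \<ge> 0" by (rule variance_positive)
  finally show ?thesis by (intro real_le_rsqrt) simp
qed

lemma monic_orthogonal_power:
  assumes "monic_orthogonal \<sigma> n p" "j < n"
  shows "(\<integral>w. poly p w * cnj w ^ j \<partial>\<sigma>) = 0"
proof -
  have "(\<integral>w. poly p w * cnj (poly (monom 1 j) w) \<partial>\<sigma>) = 0"
    using assms unfolding monic_orthogonal_def by (metis degree_monom_eq one_neq_zero)
  then show ?thesis by (simp add: poly_monom)
qed

text \<open>On the circle the reversal is \<open>w ^ n * cnj (poly p w)\<close>, so its moment
  against \<open>w ^ j\<close> is the conjugate of the moment of \<open>p\<close> against
  \<open>w ^ (n - j)\<close>. The case \<open>j = 0\<close> escapes, as \<open>p\<close> need not be
  orthogonal to \<open>w ^ n\<close>.\<close>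

lemma monic_orthogonal_rev_power:
  assumes "monic_orthogonal \<sigma> n p" "0 < j" "j \<le> n"
  shows "(\<integral>w. poly (rev_poly p) w * cnj w ^ j \<partial>\<sigma>) = 0"
proof -
  have deg: "degree p = n" using assms by (simp add: monic_orthogonal_def)
  have "(\<integral>w. poly (rev_poly p) w * cnj w ^ j \<partial>\<sigma>) = (\<integral>w. cnj (poly p w * cnj w ^ (n - j)) \<partial>\<sigma>)"
  proof (intro integral_circle_cong)
    fix w :: complex assume w: "cmod w = 1"
    then have "w * cnj w = 1" by (simp add: circle_mult_cnj)
    moreover have "w ^ n = w ^ (n - j) * w ^ j" using assms by (simp flip: power_add)
    ultimately have "w ^ n * cnj w ^ j = w ^ (n - j)"
      by (simp add: mult.assoc flip: power_mult_distrib)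
    then show "poly (rev_poly p) w * cnj w ^ j = cnj (poly p w * cnj w ^ (n - j))"
      using w by (simp add: poly_rev_poly_circle deg algebra_simps)
  qed measurable
  also have "\<dots> = cnj (\<integral>w. poly p w * cnj w ^ (n - j) \<partial>\<sigma>)"
    by (rule Bochner_Integration.integral_cnj)
  also have "\<dots> = 0" using monic_orthogonal_power[OF assms(1), of "n - j"] assms by simp
  finally show ?thesis .
qed

lemma integral_poly_cnj_poly:
  "(\<integral>w. poly p w * cnj (poly q w) \<partial>\<sigma>) =
     (\<Sum>j\<le>degree q. cnj (coeff q j) * (\<integral>w. poly p w * cnj w ^ j \<partial>\<sigma>))"
proof -
  have "(\<integral>w. poly p w * cnj (poly q w) \<partial>\<sigma>) =
      (\<integral>w. (\<Sum>j\<le>degree q. cnj (coeff q j) * (poly p w * cnj w ^ j)) \<partial>\<sigma>)"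
    by (simp add: poly_altdef[of q] sum_distrib_left mult_ac)
  also have "\<dots> = (\<Sum>j\<le>degree q. \<integral>w. cnj (coeff q j) * (poly p w * cnj w ^ j) \<partial>\<sigma>)"
    by (intro Bochner_Integration.integral_sum integrable_circle continuous_intros) measurable
  finally show ?thesis by simp
qed

text \<open>The remaining moment of the reversal: expanding one factor of the squared norm in
  powers, orthogonality leaves only the leading term, whose coefficient is 1.\<close>

lemma integral_rev_poly:
  assumes "monic_orthogonal \<sigma> n p"
  shows "(\<integral>w. poly (rev_poly p) w \<partial>\<sigma>) = sqnorm p"
proof -
  have deg: "degree p = n" "lead_coeff p = 1" using assms by (auto simp: monic_orthogonal_def)
  have "(\<Sum>j\<le>n. cnj (coeff p j) * (\<integral>w. poly p w * cnj w ^ j \<partial>\<sigma>)) =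
      (\<Sum>j\<in>{n}. cnj (coeff p j) * (\<integral>w. poly p w * cnj w ^ j \<partial>\<sigma>))"
    by (intro sum.mono_neutral_right) (auto simp: monic_orthogonal_power[OF assms])
  then have "complex_of_real (sqnorm p) = (\<integral>w. poly p w * cnj w ^ n \<partial>\<sigma>)"
    using deg by (simp add: of_real_sqnorm integral_poly_cnj_poly)
  then have "complex_of_real (sqnorm p) = cnj (\<integral>w. poly p w * cnj w ^ n \<partial>\<sigma>)"
    by (metis complex_cnj_complex_of_real)
  also have "\<dots> = (\<integral>w. cnj (poly p w * cnj w ^ n) \<partial>\<sigma>)"
    by (rule Bochner_Integration.integral_cnj[symmetric])
  also have "\<dots> = (\<integral>w. poly (rev_poly p) w \<partial>\<sigma>)"
    by (intro integral_circle_cong) (auto simp: poly_rev_poly_circle deg)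
  finally show ?thesis by simp
qed

text \<open>The moments of order 1 to \<open>n\<close> vanish for both summands, the first because
  multiplication by \<open>w\<close> shifts the powers by one. The choice of \<open>c\<close>
  removes the moment of order 0.\<close>

lemma monic_orthogonal_szego_step:
  fixes c :: complex
  assumes p: "monic_orthogonal \<sigma> n p"
    and c: "(\<integral>w. w * poly p w \<partial>\<sigma>) = c * sqnorm p"
  shows "monic_orthogonal \<sigma> (Suc n) (pCons 0 p - smult c (rev_poly p))"
proof -
  let ?q = "pCons 0 p - smult c (rev_poly p)"
  have deg: "degree p = n" "lead_coeff p = 1" using p by (auto simp: monic_orthogonal_def)
  have split: "(\<integral>w. poly ?q w * cnj w ^ j \<partial>\<sigma>) =
      (\<integral>w. w * poly p w * cnj w ^ j \<partial>\<sigma>) - c * (\<integral>w. poly (rev_poly p) w * cnj w ^ j \<partial>\<sigma>)" for j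
  proof -
    have "integrable \<sigma> (\<lambda>w. w * poly p w * cnj w ^ j)"
      by (intro integrable_circle continuous_intros) measurable
    moreover have "integrable \<sigma> (\<lambda>w. c * (poly (rev_poly p) w * cnj w ^ j))"
      by (intro integrable_circle continuous_intros) measurable
    ultimately show ?thesis
      by (simp add: left_diff_distrib mult.assoc)
  qed
  have "(\<integral>w. poly ?q w * cnj w ^ j \<partial>\<sigma>) = 0" if "j < Suc n" for j
  proof (cases j)
    case 0
    then show ?thesis unfolding split using c integral_rev_poly[OF p] by simp
  next
    case (Suc i)
    have "(\<integral>w. w * poly p w * cnj w ^ j \<partial>\<sigma>) = (\<integral>w. poly p w * cnj w ^ i \<partial>\<sigma>)"
    proof (intro integral_circle_cong)
      fix w :: complex assume "cmod w = 1"
      then have w: "w * cnj w = 1" by (simp add: circle_mult_cnj)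
      have "w * poly p w * cnj w ^ j = (w * cnj w) * (poly p w * cnj w ^ i)"
        by (simp add: Suc mult_ac)
      then show "w * poly p w * cnj w ^ j = poly p w * cnj w ^ i" by (simp add: w)
    qed measurable
    then show ?thesis
      unfolding split using monic_orthogonal_power[OF p, of i] monic_orthogonal_rev_power[OF p, of j]
        that Suc by simp
  qed
  then have "(\<integral>w. poly ?q w * cnj (poly r w) \<partial>\<sigma>) = 0" if "degree r < Suc n" for r
    unfolding integral_poly_cnj_poly using that by (intro sum.neutral) auto
  then show ?thesis
    using degree_lead_coeff_szego_step[OF deg(2), of c] deg(1) by (simp add: monic_orthogonal_def)
qed

text \<open>A vanishing norm would put the measure on the finite root set of
  \<open>p\<close>.\<close>

lemma sqnorm_pos:
  assumes "nontrivial \<sigma>" "p \<noteq> 0"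
  shows "0 < sqnorm p"
proof (rule ccontr)
  assume "\<not> 0 < sqnorm p"
  then have "(\<integral>w. (cmod (poly p w))\<^sup>2 \<partial>\<sigma>) = 0" using sqnorm_nonneg[of p] by (simp flip: sqnorm_def)
  moreover have "integrable \<sigma> (\<lambda>w. (cmod (poly p w))\<^sup>2)"
    by (intro integrable_circle continuous_intros) measurable
  ultimately have "AE w in \<sigma>. (cmod (poly p w))\<^sup>2 = 0"
    by (simp add: integral_nonneg_eq_0_iff_AE)
  then have "AE w in \<sigma>. w \<in> {w. poly p w = 0}" by simp
  then show False
    using assms poly_roots_finite[OF assms(2)] unfolding nontrivial_def by blast
qed

text \<open>The leading terms cancel, so the difference has degree below \<open>n\<close> and is
  orthogonal to itself.\<close>

lemma monic_orthogonal_unique: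
  assumes "nontrivial \<sigma>" and p: "monic_orthogonal \<sigma> n p" and q: "monic_orthogonal \<sigma> n q"
  shows "p = q"
proof (rule ccontr)
  assume "p \<noteq> q"
  let ?d = "p - q"
  have "degree p = n" "degree q = n" "lead_coeff p = lead_coeff q"
    using p q by (auto simp: monic_orthogonal_def)
  have "coeff ?d n = 0" "degree ?d \<le> n"
    using \<open>degree p = n\<close> \<open>degree q = n\<close> \<open>lead_coeff p = lead_coeff q\<close>
    by (auto intro: degree_diff_le)
  then have "degree ?d < n"
    using \<open>p \<noteq> q\<close> by (metis eq_iff_diff_eq_0 leading_coeff_0_iff order_less_le)
  then have "(\<integral>w. poly p w * cnj (poly ?d w) \<partial>\<sigma>) = 0" "(\<integral>w. poly q w * cnj (poly ?d w) \<partial>\<sigma>) = 0"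
    using p q by (auto simp: monic_orthogonal_def)
  moreover have "integrable \<sigma> (\<lambda>w. poly r w * cnj (poly ?d w))" for r
    by (intro integrable_circle continuous_intros) measurable
  ultimately have "complex_of_real (sqnorm ?d) = 0"
    using Bochner_Integration.integral_diff[of \<sigma> "\<lambda>w. poly p w * cnj (poly ?d w)"
        "\<lambda>w. poly q w * cnj (poly ?d w)"]
    unfolding of_real_sqnorm by (simp add: left_diff_distrib)
  then show False using sqnorm_pos[OF assms(1), of ?d] \<open>p \<noteq> q\<close> by simp
qed

lemma opuc_eqI:
  assumes "nontrivial \<sigma>" "monic_orthogonal \<sigma> n p"
  shows "opuc \<sigma> n = p"
  unfolding opuc_def using assms monic_orthogonal_unique by (intro the_equality) auto

text \<open>This gives existence of the orthogonal polynomials together with their recurrence. The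
  coefficient \<open>c\<close> of the step is identified by evaluating at 0, where the reversal
  equals 1 and the new polynomial equals \<open>- c\<close>.\<close>

lemma monic_orthogonal_szego_rec_verblunsky:
  assumes "nontrivial \<sigma>"
  shows "monic_orthogonal \<sigma> n (szego_rec (verblunsky \<sigma>) n)"
proof (induction n)
  case 0
  show ?case by (simp add: monic_orthogonal_def)
next
  case (Suc n)
  let ?p = "szego_rec (verblunsky \<sigma>) n"
  have "?p \<noteq> 0" using degree_lead_coeff_szego_rec[of "verblunsky \<sigma>" n] by auto
  then have pos: "sqnorm ?p > 0" using assms sqnorm_pos by blast
  define c where "c = (\<integral>w. w * poly ?p w \<partial>\<sigma>) / sqnorm ?p"
  have step: "monic_orthogonal \<sigma> (Suc n) (pCons 0 ?p - smult c (rev_poly ?p))"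
    using pos by (intro monic_orthogonal_szego_step Suc) (simp add: c_def)
  have "c = cnj (verblunsky \<sigma> n)"
    unfolding verblunsky_def opuc_eqI[OF assms step] by simp
  with step show ?case by simp
qed

definition caratheodory :: "complex \<Rightarrow> complex" where
  "caratheodory z = (\<integral>w. (w + z) / (w - z) \<partial>\<sigma>)"

end

section \<open>The linear recurrence\<close>

text \<open>A measure with coefficients whose recurrence produces its orthogonal polynomials. It is
  used for \<open>\<sigma>\<close> with its Verblunsky coefficients and for \<open>\<sigma>'\<close>
  with the shifted ones.\<close>

locale szego_system = circle_measure +
  fixes \<alpha> :: "nat \<Rightarrow> complex"
  assumes orth: "monic_orthogonal \<sigma> n (szego_rec \<alpha> n)"
begin

lemma integral_szego_rec_Suc: "(\<integral>w. poly (szego_rec \<alpha> (Suc n)) w \<partial>\<sigma>) = 0"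
  using monic_orthogonal_power[OF orth, of 0 "Suc n"] by simp

text \<open>Pythagoras applied to \<open>w\<close> times the polynomial of index \<open>n\<close>:
  by the recurrence it is the next polynomial plus a multiple of the reversal, and these are
  orthogonal by degree. Neither the factor \<open>w\<close> nor reversal changes the norm.\<close>

lemma sqnorm_szego_rec: "sqnorm (szego_rec \<alpha> n) = (\<Prod>j<n. 1 - (cmod (\<alpha> j))\<^sup>2)"
proof (induction n)
  case 0
  show ?case by (simp add: sqnorm_def prob_space)
next
  case (Suc n)
  let ?p = "szego_rec \<alpha> n" and ?q = "szego_rec \<alpha> (Suc n)"
  have "(\<integral>w. poly ?q w * cnj (poly (rev_poly ?p) w) \<partial>\<sigma>) = 0"
    using orth[of "Suc n"] degree_rev_poly_le[of ?p] by (simp add: monic_orthogonal_def)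
  then have ortho: "(\<integral>w. Re (\<alpha> n * (poly ?q w * cnj (poly (rev_poly ?p) w))) \<partial>\<sigma>) = 0"
    by (subst integral_Re) (auto intro!: integrable_circle continuous_intros)
  have i1: "integrable \<sigma> (\<lambda>w. (cmod (poly ?q w))\<^sup>2)"
    by (intro integrable_circle continuous_intros) measurable
  have i2: "integrable \<sigma> (\<lambda>w. (cmod (\<alpha> n))\<^sup>2 * (cmod (poly (rev_poly ?p) w))\<^sup>2)"
    by (intro integrable_circle continuous_intros) measurable
  have i3: "integrable \<sigma> (\<lambda>w. 2 * Re (\<alpha> n * (poly ?q w * cnj (poly (rev_poly ?p) w))))"
    by (intro integrable_circle continuous_intros) measurable
  have "sqnorm ?p = (\<integral>w. (cmod (poly ?q w))\<^sup>2 + (cmod (\<alpha> n))\<^sup>2 * (cmod (poly (rev_poly ?p) w))\<^sup>2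
      + 2 * Re (\<alpha> n * (poly ?q w * cnj (poly (rev_poly ?p) w))) \<partial>\<sigma>)"
    unfolding sqnorm_def
  proof (intro integral_circle_cong)
    fix w :: complex assume w: "cmod w = 1"
    have "w * poly ?p w = poly ?q w + cnj (\<alpha> n) * poly (rev_poly ?p) w" by simp
    then have "(cmod (poly ?p w))\<^sup>2 = (cmod (poly ?q w + cnj (\<alpha> n) * poly (rev_poly ?p) w))\<^sup>2"
      using w by (metis norm_mult mult_1)
    also have "\<dots> = (cmod (poly ?q w))\<^sup>2 + (cmod (\<alpha> n))\<^sup>2 * (cmod (poly (rev_poly ?p) w))\<^sup>2
      + 2 * Re (\<alpha> n * (poly ?q w * cnj (poly (rev_poly ?p) w)))"
      by (simp only: cmod_power2) (simp add: power2_eq_square algebra_simps)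
    finally show "(cmod (poly ?p w))\<^sup>2 = \<dots>" .
  qed measurable
  also have "\<dots> = sqnorm ?q + (cmod (\<alpha> n))\<^sup>2 * sqnorm (rev_poly ?p)"
    using i1 i2 i3 ortho unfolding sqnorm_def
    by (simp del: szego_rec.simps times_complex.simps minus_complex.simps)
  finally have "sqnorm ?q = (1 - (cmod (\<alpha> n))\<^sup>2) * sqnorm ?p"
    by (simp add: sqnorm_rev_poly algebra_simps)
  then show ?case using Suc by simp
qed

section \<open>The functions \<open>u\<close> and \<open>v\<close> and their decay inside the unit
  disc\<close>

context
  fixes z :: complex
  assumes z: "cmod z < 1"
begin

definition u :: "nat \<Rightarrow> complex" where
  "u n = poly (szego_rec \<alpha> n) z * caratheodory z + poly (szego_rec (\<lambda>j. - \<alpha> j) n) z"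

definition v :: "nat \<Rightarrow> complex" where
  "v n = poly (rev_poly (szego_rec \<alpha> n)) z * caratheodory z
     - poly (rev_poly (szego_rec (\<lambda>j. - \<alpha> j) n)) z"

text \<open>The sign change of \<alpha> in the second kind polynomials matches the minus sign in
  \<open>v\<close>, so the first and second kind parts obey one common recurrence.\<close>

lemma u_Suc: "u (Suc n) = z * u n - cnj (\<alpha> n) * v n"
  by (simp add: u_def v_def algebra_simps)

lemma v_Suc: "v (Suc n) = v n - \<alpha> n * z * u n"
  unfolding u_def v_def poly_rev_szego_rec_Suc by (simp add: algebra_simps)

lemma integrable_cauchy:
  assumes "continuous_on (sphere 0 1) f" "f \<in> borel_measurable borel"
  shows "integrable \<sigma> (\<lambda>w. f w / (w - z))"
proof (intro integrable_circle continuous_intros assms ballI)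
  fix w :: complex assume "w \<in> sphere 0 1"
  then show "w - z \<noteq> 0" using z by auto
qed (use assms in measurable)

text \<open>This form exposes the orthogonality of the polynomials under a Cauchy kernel. It holds
  initially by the definition of \<open>caratheodory\<close>, and both sides satisfy the same
  recurrence.\<close>

lemma u_v_integral:
  "u n = (\<integral>w. 2 * w * poly (szego_rec \<alpha> n) w / (w - z) \<partial>\<sigma>) \<and>
   v n = (\<integral>w. 2 * z * poly (rev_poly (szego_rec \<alpha> n)) w / (w - z) \<partial>\<sigma>)"
proof (induction n)
  case 0
  have i: "integrable \<sigma> (\<lambda>w. (w + z) / (w - z))"
    by (intro integrable_cauchy continuous_intros) measurable
  have nz: "w - z \<noteq> 0" if "cmod w = 1" for w using that z by auto
  have "(\<integral>w. 2 * w / (w - z) \<partial>\<sigma>) = (\<integral>w. (w + z) / (w - z) + 1 \<partial>\<sigma>)"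
    by (intro integral_circle_cong) (use nz in \<open>auto simp: field_simps\<close>)
  moreover have "(\<integral>w. 2 * z / (w - z) \<partial>\<sigma>) = (\<integral>w. (w + z) / (w - z) - 1 \<partial>\<sigma>)"
    by (intro integral_circle_cong) (use nz in \<open>auto simp: field_simps\<close>)
  ultimately show ?case
    using i by (simp add: u_def v_def rev_poly_def caratheodory_def prob_space)
next
  case (Suc n)
  let ?p = "szego_rec \<alpha> n"
  have nz: "w - z \<noteq> 0" if "cmod w = 1" for w using that z by auto
  have i1: "integrable \<sigma> (\<lambda>w. 2 * w * poly ?p w / (w - z))"
    by (intro integrable_cauchy continuous_intros) measurable
  have i2: "integrable \<sigma> (\<lambda>w. 2 * z * poly (rev_poly ?p) w / (w - z))"
    by (intro integrable_cauchy continuous_intros) measurable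
  have i3: "integrable \<sigma> (poly (szego_rec \<alpha> (Suc n)))"
    by (intro integrable_circle continuous_intros) measurable
  \<comment> \<open>Writing \<open>2 * w / (w - z)\<close> as \<open>2 * z / (w - z) + 2\<close>
    splits off a term that integrates to 0 by orthogonality to constants.\<close>
  have "(\<integral>w. 2 * w * poly (szego_rec \<alpha> (Suc n)) w / (w - z) \<partial>\<sigma>) =
      (\<integral>w. z * (2 * w * poly ?p w / (w - z)) - cnj (\<alpha> n) * (2 * z * poly (rev_poly ?p) w / (w - z))
        + 2 * poly (szego_rec \<alpha> (Suc n)) w \<partial>\<sigma>)"
  proof (intro integral_circle_cong)
    fix w :: complex assume "cmod w = 1"
    then have "w - z \<noteq> 0" by (rule nz)
    then show "2 * w * poly (szego_rec \<alpha> (Suc n)) w / (w - z) =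
      z * (2 * w * poly ?p w / (w - z)) - cnj (\<alpha> n) * (2 * z * poly (rev_poly ?p) w / (w - z))
        + 2 * poly (szego_rec \<alpha> (Suc n)) w"
      by (simp add: divide_simps) (simp add: algebra_simps)
  qed measurable
  also have "\<dots> = z * u n - cnj (\<alpha> n) * v n"
    using i1 i2 i3 Suc integral_szego_rec_Suc[of n]
    by (simp del: szego_rec.simps times_divide_eq_right)
  finally have 1: "u (Suc n) = (\<integral>w. 2 * w * poly (szego_rec \<alpha> (Suc n)) w / (w - z) \<partial>\<sigma>)"
    by (simp add: u_Suc)
  have "(\<integral>w. 2 * z * poly (rev_poly (szego_rec \<alpha> (Suc n))) w / (w - z) \<partial>\<sigma>) =
      (\<integral>w. 2 * z * poly (rev_poly ?p) w / (w - z) - \<alpha> n * z * (2 * w * poly ?p w / (w - z)) \<partial>\<sigma>)"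
    unfolding poly_rev_szego_rec_Suc
    by (intro Bochner_Integration.integral_cong refl)
      (simp add: diff_divide_distrib algebra_simps)
  also have "\<dots> = v n - \<alpha> n * z * u n"
    using i1 i2 Suc by (simp del: times_divide_eq_right)
  finally show ?case using 1 by (simp add: v_Suc)
qed

text \<open>Orthogonality to the first powers lets the geometric expansion of \<open>1 / (w - z)\<close> start at
  the power \<open>z ^ n\<close>.\<close>

lemma cauchy_integral_bound:
  assumes h: "\<And>w. cmod w = 1 \<Longrightarrow> cmod (h w) = cmod (poly (szego_rec \<alpha> n) w)"
    and h_cont: "continuous_on UNIV h"
    and h_orth: "\<And>j. j < n \<Longrightarrow> (\<integral>w. h w * cnj w ^ Suc j \<partial>\<sigma>) = 0"
  shows "cmod (\<integral>w. h w / (w - z) \<partial>\<sigma>) \<le> cmod z ^ n / (1 - cmod z) * sqrt (sqnorm (szego_rec \<alpha> n))"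
proof -
  have [measurable]: "h \<in> borel_measurable borel"
    using h_cont by (rule borel_measurable_continuous_onI)
  have c: "continuous_on (sphere 0 1) h" using h_cont continuous_on_subset by blast
  have nz: "w - z \<noteq> 0" if "cmod w = 1" for w using that z by auto
  have ip: "integrable \<sigma> (\<lambda>w. z ^ j * (h w * cnj w ^ Suc j))" for j
    by (intro integrable_circle continuous_intros c) measurable
  have ir: "integrable \<sigma> (\<lambda>w. z ^ n * (h w * cnj w ^ n) / (w - z))"
    by (intro integrable_cauchy continuous_intros c) measurable
  have "(\<integral>w. h w / (w - z) \<partial>\<sigma>) =
     (\<integral>w. (\<Sum>j<n. z ^ j * (h w * cnj w ^ Suc j)) + z ^ n * (h w * cnj w ^ n) / (w - z) \<partial>\<sigma>)"
  proof (intro integral_circle_cong)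
    fix w :: complex assume w: "cmod w = 1"
    then have wc: "w * cnj w = 1" by (simp add: circle_mult_cnj)
    \<comment> \<open>A finite geometric sum, with \<open>cnj w\<close> in the role of
      \<open>1 / w\<close>.\<close>
    have "(w - z) * (\<Sum>j<n. z ^ j * cnj w ^ Suc j) = 1 - (z * cnj w) ^ n"
    proof (induction n)
      case (Suc n)
      then have "(w - z) * (\<Sum>j<Suc n. z ^ j * cnj w ^ Suc j) =
          1 - (z * cnj w) ^ n + (w * cnj w - z * cnj w) * (z * cnj w) ^ n"
        by (simp add: algebra_simps power_mult_distrib)
      then show ?case by (simp add: wc algebra_simps)
    qed simp
    then have "(\<Sum>j<n. z ^ j * cnj w ^ Suc j) + z ^ n * cnj w ^ n / (w - z) = 1 / (w - z)"
      using nz[OF w] by (simp add: field_simps power_mult_distrib)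
    then have "h w * ((\<Sum>j<n. z ^ j * cnj w ^ Suc j) + z ^ n * cnj w ^ n / (w - z)) = h w / (w - z)"
      by simp
    then show "h w / (w - z) =
        (\<Sum>j<n. z ^ j * (h w * cnj w ^ Suc j)) + z ^ n * (h w * cnj w ^ n) / (w - z)"
      by (simp add: distrib_left sum_distrib_left mult_ac)
  qed measurable
  also have "\<dots> = (\<Sum>j<n. z ^ j * (\<integral>w. h w * cnj w ^ Suc j \<partial>\<sigma>))
      + (\<integral>w. z ^ n * (h w * cnj w ^ n) / (w - z) \<partial>\<sigma>)"
    using ip ir by (subst Bochner_Integration.integral_add)
      (auto simp: Bochner_Integration.integral_sum simp del: power_Suc)
  also have "\<dots> = (\<integral>w. z ^ n * (h w * cnj w ^ n) / (w - z) \<partial>\<sigma>)"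
    using h_orth by (simp del: power_Suc)
  finally have eq: "(\<integral>w. h w / (w - z) \<partial>\<sigma>) = (\<integral>w. z ^ n * (h w * cnj w ^ n) / (w - z) \<partial>\<sigma>)" .
  have "cmod (\<integral>w. z ^ n * (h w * cnj w ^ n) / (w - z) \<partial>\<sigma>)
      \<le> (\<integral>w. cmod (z ^ n * (h w * cnj w ^ n) / (w - z)) \<partial>\<sigma>)"
    by (rule integral_norm_bound)
  also have "\<dots> \<le> (\<integral>w. cmod z ^ n / (1 - cmod z) * cmod (poly (szego_rec \<alpha> n) w) \<partial>\<sigma>)"
  proof (intro integral_mono_AE)
    show "integrable \<sigma> (\<lambda>w. cmod (z ^ n * (h w * cnj w ^ n) / (w - z)))"
      using ir by (rule integrable_norm)
    show "integrable \<sigma> (\<lambda>w. cmod z ^ n / (1 - cmod z) * cmod (poly (szego_rec \<alpha> n) w))"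
      by (intro integrable_circle continuous_intros) measurable
    show "AE w in \<sigma>. cmod (z ^ n * (h w * cnj w ^ n) / (w - z))
        \<le> cmod z ^ n / (1 - cmod z) * cmod (poly (szego_rec \<alpha> n) w)"
      using AE_circle
    proof eventually_elim
      case (elim w)
      have "1 - cmod z \<le> cmod (w - z)" using elim norm_triangle_ineq2[of w z] by simp
      then have "cmod z ^ n * cmod (h w) / cmod (w - z) \<le> cmod z ^ n * cmod (h w) / (1 - cmod z)"
        using z by (intro divide_left_mono mult_pos_pos) auto
      then show ?case using elim by (simp add: norm_mult norm_divide norm_power h)
    qed
  qed
  also have "\<dots> = cmod z ^ n / (1 - cmod z) * (\<integral>w. cmod (poly (szego_rec \<alpha> n) w) \<partial>\<sigma>)"
    by simp
  \<comment> \<open>Cauchy-Schwarz passes from the L1 norm to the L2 norm.\<close>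
  also have "\<dots> \<le> cmod z ^ n / (1 - cmod z) * sqrt (sqnorm (szego_rec \<alpha> n))"
    using z by (intro mult_left_mono integral_norm_poly_le) auto
  finally show ?thesis unfolding eq .
qed

text \<open>The extra factor \<open>w\<close> in the integrand turns orthogonality to the powers 0
  to \<open>n - 1\<close> into orthogonality to the powers 1 to \<open>n\<close>, as the Cauchy
  estimate requires.\<close>

lemma u_bound: "cmod (u n) \<le> 2 / (1 - cmod z) * cmod z ^ n * sqrt (sqnorm (szego_rec \<alpha> n))"
proof -
  let ?h = "\<lambda>w. w * poly (szego_rec \<alpha> n) w"
  have orth': "(\<integral>w. ?h w * cnj w ^ Suc j \<partial>\<sigma>) = 0" if "j < n" for j
  proof -
    have "(\<integral>w. ?h w * cnj w ^ Suc j \<partial>\<sigma>) = (\<integral>w. poly (szego_rec \<alpha> n) w * cnj w ^ j \<partial>\<sigma>)"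
    proof (intro integral_circle_cong)
      fix w :: complex assume "cmod w = 1"
      then have "w * cnj w = 1" by (simp add: circle_mult_cnj)
      moreover have "?h w * cnj w ^ Suc j = (w * cnj w) * (poly (szego_rec \<alpha> n) w * cnj w ^ j)"
        by (simp add: mult_ac)
      ultimately show "?h w * cnj w ^ Suc j = poly (szego_rec \<alpha> n) w * cnj w ^ j" by simp
    qed measurable
    then show ?thesis using monic_orthogonal_power[OF orth that] by simp
  qed
  have "u n = 2 * (\<integral>w. ?h w / (w - z) \<partial>\<sigma>)"
    by (subst integral_mult_right_zero[symmetric]) (simp add: u_v_integral mult.assoc)
  moreover have "cmod (\<integral>w. ?h w / (w - z) \<partial>\<sigma>)
      \<le> cmod z ^ n / (1 - cmod z) * sqrt (sqnorm (szego_rec \<alpha> n))"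
    by (intro cauchy_integral_bound orth' continuous_intros) (auto simp: norm_mult)
  ultimately show ?thesis by (simp add: norm_mult)
qed

text \<open>The reversal is already orthogonal to the powers 1 to \<open>n\<close>. The additional
  factor \<open>z\<close> is estimated by 1.\<close>

lemma v_bound: "cmod (v n) \<le> 2 / (1 - cmod z) * cmod z ^ n * sqrt (sqnorm (szego_rec \<alpha> n))"
proof -
  let ?h = "poly (rev_poly (szego_rec \<alpha> n))"
    and ?B = "cmod z ^ n / (1 - cmod z) * sqrt (sqnorm (szego_rec \<alpha> n))"
  have orth': "(\<integral>w. ?h w * cnj w ^ Suc j \<partial>\<sigma>) = 0" if "j < n" for j
    using monic_orthogonal_rev_power[OF orth, of "Suc j" n] that by simp
  have "v n = 2 * z * (\<integral>w. ?h w / (w - z) \<partial>\<sigma>)"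
    by (subst integral_mult_right_zero[symmetric]) (simp add: u_v_integral mult.assoc)
  moreover have "cmod (\<integral>w. ?h w / (w - z) \<partial>\<sigma>) \<le> ?B"
    by (intro cauchy_integral_bound orth' continuous_intros)
      (auto simp: norm_mult norm_power poly_rev_poly_circle)
  moreover from this have "cmod z * cmod (\<integral>w. ?h w / (w - z) \<partial>\<sigma>) \<le> 1 * ?B"
    using z by (intro mult_mono) auto
  ultimately show ?thesis by (simp add: norm_mult)
qed

end

end

text \<open>Since the initial values for \<sigma>' are \<open>F' + 1\<close> and
  \<open>F' - 1\<close>, the vanishing of \<open>W 0\<close> is a linear equation for
  \<open>F'\<close>. Its coefficients \<open>?u k - ?v k\<close> and \<open>?u k + ?v k\<close> are
  the denominator and numerator of the transformation.\<close>

lemma caratheodory_associated: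
  assumes "szego_system \<sigma> \<alpha>" and "szego_system \<sigma>' (\<lambda>n. \<alpha> (n + k))"
    and \<alpha>: "\<And>n. cmod (\<alpha> n) < 1"
    and z: "cmod z < 1" "z \<noteq> 0"
  defines "F \<equiv> circle_measure.caratheodory \<sigma> z" and "F' \<equiv> circle_measure.caratheodory \<sigma>' z"
    and "\<Phi> \<equiv> szego_rec \<alpha>" and "\<Omega> \<equiv> szego_rec (\<lambda>n. - \<alpha> n)"
  shows "lft_eq F' (Upsilon \<Phi> \<Omega> k z) F"
proof -
  interpret A: szego_system \<sigma> \<alpha> by fact
  interpret B: szego_system \<sigma>' "\<lambda>n. \<alpha> (n + k)" by fact
  let ?u = "A.u z" and ?v = "A.v z" and ?u' = "B.u z" and ?v' = "B.v z"
  \<comment> \<open>A Casoratian: the shift by \<open>k\<close> makes both pairs run through the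
    recurrence with the same coefficients.\<close>
  define W where "W n = ?u (n + k) * ?v' n - ?v (n + k) * ?u' n" for n
  define d where "d n = (\<Prod>j<n. 1 - (cmod (\<alpha> (j + k)))\<^sup>2)" for n
  have pos: "0 < 1 - (cmod (\<alpha> n))\<^sup>2" for n
    using \<alpha>[of n] by (simp add: power_less_one_iff)
  have d_pos: "0 < d n" for n unfolding d_def by (intro prod_pos) (use pos in auto)
  \<comment> \<open>The first \<open>k\<close> factors of the squared norm for \<sigma>; the
    remaining ones form \<open>d n\<close>, the squared norm for \<sigma>'.\<close>
  define e where "e = (\<Prod>j<k. 1 - (cmod (\<alpha> j))\<^sup>2)"
  have e_pos: "0 < e" unfolding e_def by (intro prod_pos) (use pos in auto)
  have W_eq: "W n = z ^ n * d n * W 0" for n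
  proof (induction n)
    case (Suc n)
    \<comment> \<open>The factor is the determinant of the recurrence step.\<close>
    have "W (Suc n) = z * (1 - \<alpha> (n + k) * cnj (\<alpha> (n + k))) * W n"
      unfolding W_def add_Suc A.u_Suc[OF z(1)] A.v_Suc[OF z(1)] B.u_Suc[OF z(1)] B.v_Suc[OF z(1)]
      by (simp add: algebra_simps)
    also have "\<alpha> (n + k) * cnj (\<alpha> (n + k)) = complex_of_real ((cmod (\<alpha> (n + k)))\<^sup>2)"
      by (rule complex_norm_square[symmetric])
    finally show ?case using Suc by (simp add: d_def)
  qed (simp add: d_def)
  define C where "C = 2 / (1 - cmod z)"
  have C: "0 \<le> C" using z by (simp add: C_def)
  have sq_A: "A.sqnorm (szego_rec \<alpha> (n + k)) = e * d n" for n
    unfolding A.sqnorm_szego_rec e_def d_def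
    by (induction n) (auto simp: mult_ac)
  have sq_B: "B.sqnorm (szego_rec (\<lambda>n. \<alpha> (n + k)) n) = d n" for n
    unfolding B.sqnorm_szego_rec d_def ..
  have W_bound: "cmod (W 0) \<le> 2 * C * C * sqrt e * cmod z ^ n" for n
  proof -
    let ?a = "C * cmod z ^ (n + k) * sqrt (e * d n)" and ?b = "C * cmod z ^ n * sqrt (d n)"
    have u: "cmod (?u (n + k)) \<le> ?a" and v: "cmod (?v (n + k)) \<le> ?a"
      using A.u_bound[OF z(1), of "n + k"] A.v_bound[OF z(1), of "n + k"] by (auto simp: sq_A C_def)
    have u': "cmod (?u' n) \<le> ?b" and v': "cmod (?v' n) \<le> ?b"
      using B.u_bound[OF z(1), of n] B.v_bound[OF z(1), of n] by (auto simp: sq_B C_def)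
    have ab: "0 \<le> ?a" "0 \<le> ?b" using C d_pos[of n] e_pos by auto
    have "cmod z ^ n * d n * cmod (W 0) = cmod (W n)"
      using d_pos[of n] by (simp add: W_eq[of n] norm_mult norm_power)
    also have "\<dots> \<le> cmod (?u (n + k)) * cmod (?v' n) + cmod (?v (n + k)) * cmod (?u' n)"
      unfolding W_def using norm_triangle_ineq4 by (metis norm_mult)
    also have "\<dots> \<le> ?a * ?b + ?a * ?b"
      using u v u' v' ab by (intro add_mono mult_mono) auto
    \<comment> \<open>The factor \<open>d n\<close>, which may tend to 0, occurs on both sides and
      cancels; one power \<open>cmod z ^ n\<close> survives.\<close>
    also have "\<dots> = cmod z ^ n * d n * (2 * C * C * sqrt e * cmod z ^ n * cmod z ^ k)"
    proof -
      have "sqrt (e * d n) * sqrt (d n) = sqrt e * d n"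
        using d_pos[of n] by (simp add: real_sqrt_mult)
      moreover have "?a * ?b =
          C * C * cmod z ^ n * cmod z ^ n * cmod z ^ k * (sqrt (e * d n) * sqrt (d n))"
        by (simp only: power_add mult_ac)
      ultimately have eq: "?a * ?b =
          C * C * cmod z ^ n * cmod z ^ n * cmod z ^ k * (sqrt e * d n)"
        by (simp only:)
      show ?thesis unfolding eq by (simp add: mult_ac)
    qed
    finally have "cmod (W 0) \<le> 2 * C * C * sqrt e * cmod z ^ n * cmod z ^ k"
      using d_pos[of n] z by (subst (asm) mult_le_cancel_left_pos) auto
    also have "\<dots> \<le> 2 * C * C * sqrt e * cmod z ^ n * 1"
      using z C e_pos by (intro mult_left_mono power_le_one) auto
    finally show ?thesis by simp
  qed
  have "(\<lambda>n. 2 * C * C * sqrt e * cmod z ^ n) \<longlonglongrightarrow> 2 * C * C * sqrt e * 0"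
    using z by (intro tendsto_intros LIMSEQ_power_zero) auto
  then have "cmod (W 0) \<le> 0"
    using W_bound by (intro LIMSEQ_le_const[of _ 0 "cmod (W 0)"]) auto
  then have W0: "?u k * (F' - 1) = ?v k * (F' + 1)"
    by (simp add: W_def F'_def B.u_def[OF z(1)] B.v_def[OF z(1)] rev_poly_def)
  \<comment> \<open>The recurrence step is invertible because \<open>z\<close> is nonzero and the
    coefficients lie strictly inside the disc, so the pair never becomes zero.\<close>
  have nonzero: "?u n \<noteq> 0 \<or> ?v n \<noteq> 0" for n
  proof (induction n)
    case 0
    have "?u 0 - ?v 0 = 2" by (simp add: A.u_def[OF z(1)] A.v_def[OF z(1)] rev_poly_def)
    then show ?case by auto
  next
    case (Suc n)
    have "cnj (\<alpha> n) * \<alpha> n = complex_of_real ((cmod (\<alpha> n))\<^sup>2)"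
      by (metis complex_norm_square mult.commute)
    then have ne: "1 - cnj (\<alpha> n) * \<alpha> n \<noteq> 0"
      using pos[of n] by (metis of_real_1 of_real_diff of_real_eq_0_iff less_irrefl)
    \<comment> \<open>The step is inverted by its adjugate matrix.\<close>
    have "z * (1 - cnj (\<alpha> n) * \<alpha> n) * ?u n = ?u (Suc n) + cnj (\<alpha> n) * ?v (Suc n)"
      "(1 - cnj (\<alpha> n) * \<alpha> n) * ?v n = ?v (Suc n) + \<alpha> n * ?u (Suc n)"
      unfolding A.u_Suc[OF z(1)] A.v_Suc[OF z(1)] by (simp_all add: algebra_simps)
    then show ?case using Suc ne z(2) by auto
  qed
  have F': "F' * (?u k - ?v k) = ?u k + ?v k"
    using W0 by (simp add: algebra_simps)
  have den: "?u k - ?v k \<noteq> 0"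
  proof
    assume "?u k - ?v k = 0"
    with F' have "?u k + ?v k = 0" "?u k = ?v k" by auto
    then show False using nonzero[of k] by auto
  qed
  let ?M = "Upsilon \<Phi> \<Omega> k z"
  have "?M$1$1 * F + ?M$1$2 = ?u k + ?v k" "?M$2$1 * F + ?M$2$2 = ?u k - ?v k"
    by (simp_all add: Upsilon_def A.u_def[OF z(1)] A.v_def[OF z(1)] \<Phi>_def \<Omega>_def F_def algebra_simps)
  then show ?thesis
    using F' den unfolding lft_eq_def by (simp only: eq_divide_eq) simp
qed

section \<open>The Szego transformation\<close>

text \<open>For the two roots \<open>s\<close> and \<open>- s\<close>, the numbers
  \<open>x - s\<close> and \<open>x + s\<close> have product 1, so exactly one lies in the open disc
  unless both lie on the circle. In that case they are conjugate and their mean \<open>x\<close> is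
  real in the interval.\<close>

lemma sqrt_branch_works:
  assumes "x \<notin> complex_of_real ` {-1..1}"
  shows "(sqrt_branch x)\<^sup>2 = x\<^sup>2 - 1 \<and> cmod (x - sqrt_branch x) < 1"
proof -
  define s where "s = csqrt (x\<^sup>2 - 1)"
  have s: "s\<^sup>2 = x\<^sup>2 - 1" by (simp add: s_def)
  then have "(x - s) * (x + s) = 1" by (simp add: power2_eq_square algebra_simps)
  then have prod: "cmod (x - s) * cmod (x + s) = 1" by (metis norm_mult norm_one)
  have "cmod (x - s) \<noteq> 1"
  proof
    assume 1: "cmod (x - s) = 1"
    then have "(x - s) * cnj (x - s) = 1" by (rule circle_mult_cnj)
    with \<open>(x - s) * (x + s) = 1\<close> 1 have "x + s = cnj (x - s)"
      by (metis mult_left_cancel mult_zero_left zero_neq_one)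
    then have "2 * x = (x - s) + cnj (x - s)" by (metis add_diff_eq diff_add_cancel mult_2 add.commute)
    also have "\<dots> = complex_of_real (2 * Re (x - s))" by (rule complex_add_cnj)
    finally have "x = complex_of_real (Re (x - s))"
      unfolding of_real_mult of_real_numeral by (rule mult_left_cancel[THEN iffD1, rotated]) simp
    moreover have "\<bar>Re (x - s)\<bar> \<le> 1" using abs_Re_le_cmod[of "x - s"] 1 by simp
    ultimately show False using assms by (metis abs_le_iff atLeastAtMost_iff image_eqI minus_le_iff)
  qed
  with prod have or: "cmod (x - s) < 1 \<and> cmod (x + s) > 1 \<or> cmod (x + s) < 1 \<and> cmod (x - s) > 1"
  proof -
    have "x - s \<noteq> 0" using prod by auto
    then have "cmod (x + s) = 1 / cmod (x - s)" "0 < cmod (x - s)"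
      using prod by (auto simp: eq_divide_eq mult.commute)
    with \<open>cmod (x - s) \<noteq> 1\<close> show ?thesis by (auto simp: less_divide_eq divide_less_eq)
  qed
  have "\<exists>!w. w\<^sup>2 = x\<^sup>2 - 1 \<and> cmod (x - w) < 1"
  proof -
    have "w = s \<or> w = - s" if "w\<^sup>2 = x\<^sup>2 - 1" for w
      using that s by (metis power2_eq_iff)
    with or s show ?thesis
      by (metis diff_minus_eq_add less_asym power2_minus)
  qed
  then show ?thesis unfolding sqrt_branch_def by (rule theI')
qed

section \<open>The lifted measure on the circle\<close>

lemma szego_lift_circle:
  assumes "y \<in> {-1..1}" "s = 1 \<or> s = -1"
  shows "cmod (Complex y (s * sqrt (1 - y\<^sup>2))) = 1"
proof -
  have "y\<^sup>2 \<le> 1" using assms by (simp add: abs_square_le_1 abs_le_iff)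
  then show ?thesis using assms by (auto simp: cmod_def power_mult_distrib)
qed

lemma prob_on_szego_transform:
  assumes "prob_on {-1..1} \<nu>"
  shows "prob_on (sphere 0 1) (szego_transform \<nu>)"
proof -
  let ?P = "measure_pmf (pmf_of_set {1, -1 :: real})"
  let ?f = "\<lambda>(y, s). Complex y (s * sqrt (1 - y\<^sup>2))"
  have \<nu>: "prob_space \<nu>" "sets \<nu> = sets borel" "AE y in \<nu>. y \<in> {-1..1}"
    using assms by (auto simp: prob_on_def)
  interpret prob_space \<nu> by fact
  interpret PP: pair_prob_space \<nu> ?P ..
  note m = measurable_szego_lift[OF \<nu>(2), of "pmf_of_set {1, -1}"]
  have [measurable_cong]: "sets \<nu> = sets borel" by fact
  note [measurable] = m
  have "AE y in \<nu>. AE s in ?P. ?f (y, s) \<in> sphere 0 1"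
    using \<nu>(3)
  proof eventually_elim
    case (elim y)
    show ?case
      using szego_lift_circle[OF elim] by (auto simp: AE_measure_pmf_iff set_pmf_of_set)
  qed
  then have "AE p in \<nu> \<Otimes>\<^sub>M ?P. ?f p \<in> sphere 0 1"
    by (intro PP.AE_pair_measure measurable_sets_Collect[OF m]) auto
  then have "AE w in szego_transform \<nu>. w \<in> sphere 0 1"
    unfolding szego_transform_def by (subst AE_distr_iff[OF m]) auto
  moreover have "prob_space (szego_transform \<nu>)"
    unfolding szego_transform_def using m by (rule PP.prob_space_distr)
  ultimately show ?thesis by (simp add: prob_on_def) (simp add: szego_transform_def)
qed

text \<open>The real part pushes the transform back to \<nu>, so a finite carrier would project to a
  finite carrier of \<nu>.\<close>

lemma nontrivial_szego_transform:
  assumes "sets \<nu> = sets borel" "nontrivial \<nu>"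
  shows "nontrivial (szego_transform \<nu>)"
  unfolding nontrivial_def
proof clarify
  fix A :: "complex set" assume A: "finite A" "AE w in szego_transform \<nu>. w \<in> A"
  have "Re \<in> borel_measurable (szego_transform \<nu>)" by (simp add: szego_transform_def)
  moreover have "{x \<in> space borel. x \<in> Re ` A} \<in> sets borel"
    using A(1) by (auto intro!: borel_closed finite_imp_closed)
  moreover have "AE w in szego_transform \<nu>. Re w \<in> Re ` A" using A(2) by auto
  ultimately have "AE y in distr (szego_transform \<nu>) borel Re. y \<in> Re ` A"
    by (subst AE_distr_iff) auto
  then have "AE y in \<nu>. y \<in> Re ` A" unfolding distr_Re_szego_transform[OF assms(1)] .
  then show False using assms(2) A(1) unfolding nontrivial_def by blast
qed

text \<open>Averaging the kernel \<open>(w + z) / (w - z)\<close> over \<open>w\<close> and its conjugate gives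
  \<open>(1 - z\<^sup>2) / (1 - 2 y z + z\<^sup>2)\<close> with \<open>y = Re w\<close>, a multiple of \<open>1 / (x - y)\<close>.\<close>

lemma caratheodory_szego_transform:
  assumes \<nu>: "prob_on {-1..1} \<nu>" and x: "x \<notin> complex_of_real ` {-1..1}"
  shows "circle_measure.caratheodory (szego_transform \<nu>) (x - sqrt_branch x)
    = sqrt_branch x * S_function \<nu> x"
proof -
  let ?P = "measure_pmf (pmf_of_set {1, -1 :: real})"
  let ?f = "\<lambda>(y, s). Complex y (s * sqrt (1 - y\<^sup>2))"
  define r where "r = sqrt_branch x"
  define z where "z = x - r"
  have r: "r\<^sup>2 = x\<^sup>2 - 1" and z: "cmod z < 1"
    using sqrt_branch_works[OF x] by (auto simp: r_def z_def)
  have pr: "prob_space \<nu>" and sets: "sets \<nu> = sets borel" and AE1: "AE y in \<nu>. y \<in> {-1..1}"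
    using \<nu> by (auto simp: prob_on_def)
  interpret N: prob_space \<nu> by fact
  interpret PP: pair_prob_space \<nu> ?P ..
  interpret circle_measure "szego_transform \<nu>"
    by unfold_locales (rule prob_on_szego_transform[OF \<nu>])
  have [measurable_cong]: "sets \<nu> = sets borel" by fact
  note m [measurable] = measurable_szego_lift[OF sets, of "pmf_of_set {1, -1}"]
  let ?K = "\<lambda>w. (w + z) / (w - z)"
  have K_int: "integrable (szego_transform \<nu>) ?K"
    using z by (intro integrable_circle continuous_intros) auto
  have K_int': "integrable (\<nu> \<Otimes>\<^sub>M ?P) (\<lambda>(y, s). ?K (?f (y, s)))"
    using K_int unfolding szego_transform_def case_prod_eta
    by (subst (asm) integrable_distr_eq) (auto simp: m case_prod_unfold)
  have "caratheodory z = (\<integral>p. ?K (?f p) \<partial>(\<nu> \<Otimes>\<^sub>M ?P))"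
    unfolding caratheodory_def unfolding szego_transform_def
    by (subst integral_distr) (auto simp: m)
  \<comment> \<open>Fubini: the inner integral over the sign is the average over the two points
    above \<open>y\<close>.\<close>
  also have "\<dots> = (\<integral>y. (\<integral>s. ?K (?f (y, s)) \<partial>?P) \<partial>\<nu>)"
    using PP.integral_fst'[OF K_int'[unfolded case_prod_eta]] by (simp add: case_prod_unfold)
  also have "\<dots> = (\<integral>y. r * (1 / (x - complex_of_real y)) \<partial>\<nu>)"
  proof (rule integral_cong_AE)
    show "AE y in \<nu>. (\<integral>s. ?K (?f (y, s)) \<partial>?P) = r * (1 / (x - complex_of_real y))"
      using AE1
    proof eventually_elim
      case (elim y)
      define w where "w = Complex y (sqrt (1 - y\<^sup>2))"
      have cw: "cmod w = 1" using szego_lift_circle[OF elim, of 1] by (simp add: w_def)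
      have cnjw: "Complex y (- sqrt (1 - y\<^sup>2)) = cnj w" by (simp add: w_def complex_eq_iff)
      have wc: "w * cnj w = 1" using cw by (simp add: circle_mult_cnj)
      have sum: "w + cnj w = 2 * complex_of_real y" by (simp add: complex_eq_iff w_def)
      have nz: "w - z \<noteq> 0" "cnj w - z \<noteq> 0" using cw z by auto
      have z0: "z \<noteq> 0" using r by (auto simp: z_def)
      have xy: "x - complex_of_real y \<noteq> 0" using x elim by auto
      have "(\<integral>s. ?K (?f (y, s)) \<partial>?P) = (?K w + ?K (cnj w)) / 2"
      proof -
        have "(\<integral>s. ?K (?f (y, s)) \<partial>?P) = (\<Sum>s\<in>{1, -1}. (1 / 2) *\<^sub>R ?K (?f (y, s)))"
          by (subst integral_measure_pmf[of "{1, -1}"]) (auto simp: set_pmf_of_set)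
        also have "\<dots> = (1 / 2) *\<^sub>R (?K w + ?K (cnj w))"
          by (simp add: cnjw w_def[symmetric] scaleR_add_right del: scaleR_scaleR)
        finally show ?thesis by (simp add: scaleR_conv_of_real)
      qed
      also have "\<dots> = ((w + z) * (cnj w - z) + (cnj w + z) * (w - z)) / 2 / ((w - z) * (cnj w - z))"
        using nz by (simp add: add_frac_eq)
      also have "(w + z) * (cnj w - z) + (cnj w + z) * (w - z) = 2 * (w * cnj w) - 2 * z\<^sup>2"
        by (simp add: algebra_simps power2_eq_square)
      \<comment> \<open>From \<open>r\<^sup>2 = x\<^sup>2 - 1\<close> and \<open>z = x - r\<close>
        follow \<open>1 - z\<^sup>2 = 2 * z * r\<close> here and
        \<open>1 + z\<^sup>2 = 2 * z * x\<close> for the denominator below.\<close>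
      also have "\<dots> = 2 * (2 * z * r)"
        using r unfolding wc z_def by algebra
      also have "(w - z) * (cnj w - z) = w * cnj w - z * (w + cnj w) + z\<^sup>2"
        by (simp add: algebra_simps power2_eq_square)
      also have "\<dots> = 2 * z * (x - complex_of_real y)"
        using r unfolding wc sum z_def by algebra
      also have "2 * (2 * z * r) / 2 / (2 * z * (x - complex_of_real y))
          = r * (1 / (x - complex_of_real y))"
        using xy z0 by (simp add: divide_simps)
      finally show ?case .
    qed
  qed (use sets in measurable)
  also have "\<dots> = r * S_function \<nu> x" unfolding S_function_def by (rule integral_mult_right_zero)
  finally show ?thesis by (simp add: z_def r_def)
qed

theorem theorem6:
  fixes \<mu> \<mu>' :: "real measure" and \<sigma> \<sigma>' :: "complex measure"
    and \<Phi> \<Omega> :: "nat \<Rightarrow> complex poly" and k :: nat and x :: complex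
  assumes "prob_on {-1..1} \<mu>" and "nontrivial \<mu>"
    and "\<sigma> = szego_transform \<mu>"
    and "\<Phi> = opuc \<sigma>" and "\<Omega> = second_kind \<sigma>"
    and "k \<ge> 1"
    and "prob_on (sphere 0 1) \<sigma>'" and "\<forall>n. monic_orthogonal \<sigma>' n (associated_opuc \<sigma> k n)"
    and "prob_on {-1..1} \<mu>'" and "szego_transform \<mu>' = \<sigma>'"
    and "x \<notin> complex_of_real ` {-1..1}"
  shows "lft_eq (sqrt_branch x * S_function \<mu>' x)
           (Upsilon \<Phi> \<Omega> k (x - sqrt_branch x))
           (sqrt_branch x * S_function \<mu> x)"
proof -
  let ?\<alpha> = "verblunsky \<sigma>" and ?z = "x - sqrt_branch x"
  interpret circle_measure \<sigma>
    using prob_on_szego_transform[OF assms(1)] assms(3) by unfold_locales simp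
  have nt: "nontrivial \<sigma>"
    using nontrivial_szego_transform[of \<mu>] assms by (simp add: prob_on_def)
  interpret A: szego_system \<sigma> ?\<alpha>
    by unfold_locales (rule monic_orthogonal_szego_rec_verblunsky[OF nt])
  have B: "szego_system \<sigma>' (\<lambda>n. ?\<alpha> (n + k))"
    using assms(7,8) by unfold_locales (auto simp: associated_opuc_def)
  have \<Phi>: "\<Phi> = szego_rec ?\<alpha>"
    using opuc_eqI[OF nt A.orth] assms(4) by auto
  \<comment> \<open>The ratio of consecutive squared norms is
    \<open>1 - (cmod (?\<alpha> n))\<^sup>2\<close>, and both norms are positive by
    nontriviality.\<close>
  have \<alpha>: "cmod (?\<alpha> n) < 1" for n
  proof -
    have "0 < sqnorm (szego_rec ?\<alpha> m)" for m
      using degree_lead_coeff_szego_rec[of ?\<alpha> m] by (intro sqnorm_pos[OF nt]) auto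
    from this[of n] this[of "Suc n"] have "0 < 1 - (cmod (?\<alpha> n))\<^sup>2"
      unfolding A.sqnorm_szego_rec by (simp add: zero_less_mult_iff)
    then show ?thesis by (simp add: abs_square_less_1)
  qed
  have sq: "(sqrt_branch x)\<^sup>2 = x\<^sup>2 - 1" and z: "cmod ?z < 1"
    using sqrt_branch_works[OF assms(11)] by auto
  have "?z \<noteq> 0"
  proof
    assume "?z = 0"
    then have "sqrt_branch x = x" by (metis eq_iff_diff_eq_0)
    with sq show False by simp
  qed
  \<comment> \<open>Both products of the root with an S-function are Caratheodory functions at
    \<open>?z\<close>, so the relation between those functions is the claim.\<close>
  then show ?thesis
    using caratheodory_associated[OF A.szego_system_axioms B \<alpha> z]
      caratheodory_szego_transform[OF assms(1,11)] caratheodory_szego_transform[OF assms(9,11)]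
      assms(3,10) \<Phi> assms(5)
    by (simp add: second_kind_def)
qed

end
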